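(* Let $q$ be a positive integer. Then $$\sum_{n=1}^{\infty}\frac{1}{n!\;q^{\binom{n+q-1}{q}}}$$ is irrational.
   Context: $\binom{n+q-1}{q}$ is the ordinary binomial coefficient. *)

theory Defs
  imports "HOL-Analysis.Infinite_Sum"
begin

end

theory Submission
  imports Defs
begin

text \<open>
  The denominators \<open>e n\<close> form a divisibility chain whose quotients grow at least like \<open>n\<close>. If the sum
  were \<open>a / c\<close>, then multiplying by \<open>c * e c\<close> would make the sum and its partial sum up to \<open>c\<close>
  integers, whereas comparison with a geometric series of ratio \<open>1 / (c + 2)\<close> puts the scaled tail
  strictly between 0 and 1.
\<close>

text \<open>Replacing each growth factor \<open>N + j + 2\<close> by the smallest one,
  \<open>N + 2\<close>, turns their product into a power, so that tails can be compared with a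
  geometric series.\<close>

lemma power_mult_le_of_growth:
  fixes e :: "nat \<Rightarrow> nat"
  assumes growth: "\<And>n. (n + 2) * e n \<le> e (Suc n)"
  shows "(N + 2) ^ k * e N \<le> e (N + k)"
proof (induction k)
  case (Suc k)
  have "(N + 2) ^ Suc k * e N \<le> (N + 2) * e (N + k)"
    using mult_le_mono2[OF Suc.IH, of "N + 2"] by (simp only: power_Suc mult.assoc)
  also have "\<dots> \<le> (N + k + 2) * e (N + k)"
    by (intro mult_right_mono) auto
  also have "\<dots> \<le> e (N + Suc k)"
    using growth[of "N + k"] by simp
  finally show ?case .
qed simp

text \<open>Used for two starting points: \<open>N = 0\<close> gives ratio 1/2 and hence
  summability, and \<open>N = c\<close> gives the small ratio needed to bound the tail.\<close>

lemma inverse_le_geometric: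
  fixes e :: "nat \<Rightarrow> nat"
  assumes pos: "\<And>n. e n > 0"
    and growth: "\<And>n. (n + 2) * e n \<le> e (Suc n)"
  shows "1 / real (e (N + k)) \<le> (1 / real (N + 2)) ^ k / real (e N)"
proof -
  have "real ((N + 2) ^ k * e N) \<le> real (e (N + k))"
    using power_mult_le_of_growth[OF growth] of_nat_le_iff by blast
  then have "1 / real (e (N + k)) \<le> 1 / real ((N + 2) ^ k * e N)"
    using pos[of N] by (intro divide_left_mono) (auto simp: pos)
  then show ?thesis
    by (simp add: power_one_over field_simps)
qed

lemma summable_inverse_of_growth:
  fixes e :: "nat \<Rightarrow> nat"
  assumes pos: "\<And>n. e n > 0"
    and growth: "\<And>n. (n + 2) * e n \<le> e (Suc n)"
  shows "summable (\<lambda>n. 1 / real (e n))"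
proof (rule summable_comparison_test')
  show "summable (\<lambda>n. (1 / real (0 + 2)) ^ n / real (e 0))"
    by (intro summable_divide summable_geometric) auto
  show "norm (1 / real (e n)) \<le> (1 / real (0 + 2)) ^ n / real (e 0)" if "n \<ge> 0" for n
    using inverse_le_geometric[OF pos growth, of 0 n] by simp
qed

lemma suminf_inverse_irrational:
  fixes e :: "nat \<Rightarrow> nat"
  assumes pos: "\<And>n. e n > 0"
    and dvd: "\<And>n. e n dvd e (Suc n)"
    and growth: "\<And>n. (n + 2) * e n \<le> e (Suc n)"
  shows "(\<Sum>n. 1 / real (e n)) \<notin> \<rat>"
proof
  let ?S = "\<Sum>n. 1 / real (e n)"
  assume "?S \<in> \<rat>"
  then obtain a b :: int where ab: "b > 0" "?S = of_int a / of_int b"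
    by (rule Rats_cases') auto
  \<comment> \<open>The denominator also serves as the cut-off index: the ratio of the tail estimate
    then shrinks with \<open>c\<close>, which compensates for multiplying by
    \<open>c\<close>.\<close>
  define c where "c = nat b"
  have c: "c > 0" "real c * ?S = of_int a"
    using ab by (auto simp: c_def)
  define T where "T = (\<Sum>k. 1 / real (e (k + Suc c)))"
  note summ = summable_inverse_of_growth[OF pos growth]
  have summT: "summable (\<lambda>k. 1 / real (e (k + Suc c)))"
    using summ by (subst summable_iff_shift)
  have split: "?S = T + (\<Sum>n<Suc c. 1 / real (e n))"
    unfolding T_def by (rule suminf_split_initial_segment[OF summ])
  have "T > 0"
    unfolding T_def using summT by (rule suminf_pos) (simp add: pos)
  \<comment> \<open>The tail starts at index \<open>Suc c\<close>, one step beyond \<open>c\<close>,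
    which yields the extra factor \<open>1 / (c + 2)\<close>. Summing the series turns
    \<open>c + 2\<close> into \<open>c + 1\<close>, so the scaled tail is at most
    \<open>c / (c + 1)\<close>.\<close>
  have "T \<le> (\<Sum>k. (1 / real (c + 2)) ^ k * (1 / (real (c + 2) * real (e c))))"
    unfolding T_def
  proof (rule suminf_le[OF _ summT])
    show "summable (\<lambda>k. (1 / real (c + 2)) ^ k * (1 / (real (c + 2) * real (e c))))"
      by (intro summable_mult2 summable_geometric) auto
    show "1 / real (e (k + Suc c)) \<le> (1 / real (c + 2)) ^ k * (1 / (real (c + 2) * real (e c)))" for k
      using inverse_le_geometric[OF pos growth, of c "Suc k"] by (simp add: add.commute)
  qed
  also have "\<dots> = 1 / (1 - 1 / real (c + 2)) * (1 / (real (c + 2) * real (e c)))"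
    by (subst suminf_mult2[symmetric], (intro summable_geometric; simp),
        subst suminf_geometric) auto
  also have "\<dots> = 1 / (real (c + 1) * real (e c))"
    using pos[of c] by (simp add: divide_simps)
  finally have "real c * real (e c) * T \<le> real c * real (e c) * (1 / (real (c + 1) * real (e c)))"
    by (intro mult_left_mono) auto
  also have "\<dots> = real c / real (c + 1)"
    using pos[of c] by simp
  also have "\<dots> < 1"
    by simp
  finally have less: "real c * real (e c) * T < 1" .
  have "real (e c) / real (e n) \<in> \<int>" if "n \<le> c" for n
  proof -
    have "e n dvd e c"
      using that by (induction rule: dec_induct) (auto intro: dvd dvd_trans)
    then show ?thesis
      using pos[of n] by (auto elim!: dvdE)
  qed
  then have "(\<Sum>n<Suc c. real (e c) / real (e n)) \<in> \<int>"
    by (intro Ints_sum) auto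
  \<comment> \<open>Multiply \<open>split\<close> by \<open>c * e c\<close> and replace
    \<open>c * ?S\<close> by \<open>a\<close>; both terms on the right are then integers.\<close>
  moreover have "real c * real (e c) * T
      = of_int a * real (e c) - real c * (\<Sum>n<Suc c. real (e c) / real (e n))"
  proof -
    have "real c * real (e c) * T = real c * ?S * real (e c)
        - real c * (real (e c) * (\<Sum>n<Suc c. 1 / real (e n)))"
      unfolding split by (simp only: algebra_simps)
    then show ?thesis
      by (simp only: c(2) sum_distrib_left times_divide_eq_right mult_1_right)
  qed
  ultimately have "real c * real (e c) * T \<in> \<int>"
    by (metis Ints_diff Ints_mult Ints_of_int Ints_of_nat)
  moreover have "real c * real (e c) * T > 0"
    using c(1) pos[of c] \<open>T > 0\<close> by simp
  ultimately show False
    using less by (auto elim!: Ints_cases)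
qed

theorem corollary62:
  fixes q :: nat
  assumes "q > 0"
  shows "(\<Sum>\<^sub>\<infinity>n::nat\<in>{1..}. 1 / (fact n * real q ^ ((n + q - 1) choose q))) \<notin> \<rat>"
proof -
  \<comment> \<open>Shifted index: \<open>e n\<close> is the denominator of the term numbered
    \<open>n + 1\<close>, which also removes the truncated subtraction.\<close>
  define e :: "nat \<Rightarrow> nat" where "e n = fact (Suc n) * q ^ ((n + q) choose q)" for n
  have pos: "e n > 0" for n
    using assms by (simp add: e_def)
  \<comment> \<open>The factor \<open>n + 2\<close> comes from the factorials alone; the powers of
    \<open>q\<close> divide one another because the binomial coefficient is monotone in its upper
    argument. Both the divisibility chain and the growth bound follow from this.\<close>
  have ratio: "(n + 2) * e n dvd e (Suc n)" for n
  proof -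
    have "q ^ ((n + q) choose q) dvd q ^ ((Suc n + q) choose q)"
      by (intro le_imp_power_dvd binomial_right_mono) simp
    then have "((n + 2) * fact (Suc n)) * q ^ ((n + q) choose q)
        dvd fact (Suc (Suc n)) * q ^ ((Suc n + q) choose q)"
      by (intro mult_dvd_mono) simp_all
    then show ?thesis
      by (simp only: e_def mult.assoc)
  qed
  have dvd: "e n dvd e (Suc n)" for n
    using ratio by (rule dvd_mult_right)
  have growth: "(n + 2) * e n \<le> e (Suc n)" for n
    using ratio pos by (rule dvd_imp_le)
  have "(\<Sum>\<^sub>\<infinity>n\<in>{1..}. 1 / (fact n * real q ^ ((n + q - 1) choose q)))
      = (\<Sum>\<^sub>\<infinity>n\<in>range Suc. 1 / (fact n * real q ^ ((n + q - 1) choose q)))"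
    by (intro arg_cong2[where f = infsum]) (auto simp: image_iff Suc_le_eq gr0_conv_Suc)
  also have "\<dots> = (\<Sum>\<^sub>\<infinity>n. 1 / real (e n))"
    by (subst infsum_reindex) (auto simp: e_def o_def simp del: fact_Suc)
  \<comment> \<open>For nonnegative terms, convergence of the series already gives the unordered
    sum.\<close>
  also have "\<dots> = (\<Sum>n. 1 / real (e n))"
    using summable_inverse_of_growth[OF pos growth]
    by (intro infsumI sums_nonneg_imp_has_sum summable_sums) auto
  finally show ?thesis
    using suminf_inverse_irrational[OF pos dvd growth] by simp
qed

end
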